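(* Let $p$ be an odd prime and $z$ a nonzero integer with $\gcd(p,z)=1$. Then for each $r\in\mathbb{N}$ there is a $p$-adic integer $c_r$, depending only on $r$ (for the given $z$), such that $$\sum_{k=0}^{p-1}(2k+1)^{2r+2}D_k(z)\equiv c_r \sum_{k=0}^{p-1}D_k(z) \pmod {p}.$$
   Context: The central Delannoy polynomials are $D_k(z)=\sum_{i=0}^{k}\binom{k}{i}\binom{k+i}{i}z^i$ for $k\in\mathbb{N}=\{0,1,2,\dots\}$. *)

theory Defs
  imports Complex_Main "HOL-Computational_Algebra.Primes"
begin

definition delannoy_poly :: "nat \<Rightarrow> int \<Rightarrow> int" where
  "delannoy_poly k z = (\<Sum>i\<le>k. int (k choose i) * int ((k + i) choose i) * z ^ i)"

(* A constant that does not depend on p can be read as a p-adic integer for varying p only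
   when it is rational.  For prime p, the rationals lying in the ring of p-adic integers are
   those whose reduced denominator is prime to p; quotient_of gives the reduced fraction. *)
definition padic_integral :: "nat \<Rightarrow> rat \<Rightarrow> bool" where
  "padic_integral p x \<longleftrightarrow> \<not> int p dvd snd (quotient_of x)"

(* Congruence modulo p in the p-adic integers: the difference lies in p times that ring. *)
definition padic_cong :: "nat \<Rightarrow> rat \<Rightarrow> rat \<Rightarrow> bool" where
  "padic_cong p x y \<longleftrightarrow> (\<exists>w. padic_integral p w \<and> x - y = of_nat p * w)"

end

theory Submission
  imports Defs "HOL-Computational_Algebra.Polynomial"
begin

text \<open>
  The three-term recurrence of the \<open>D\<^sub>k(z)\<close> gives, by Abel summation, for every \<open>f\<close> an identity
  whose left side is the sum over \<open>k < p\<close> of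
  \<open>(k f(k-1) + (k+1) f(k+1) - (2k+1)(2z+1) f(k)) D\<^sub>k(z)\<close> and whose right side is divisible by \<open>p\<close>.
  For \<open>f(k) = x\<^sup>2\<^sup>n\<^sup>+\<^sup>1\<close> with \<open>x = 2k + 1\<close>, twice the factor of \<open>D\<^sub>k(z)\<close> is a polynomial in \<open>x\<^sup>2\<close>
  with leading term \<open>-4z x\<^sup>2\<^sup>n\<^sup>+\<^sup>2\<close>.  This reduces the moment of order \<open>2n + 2\<close> modulo \<open>p\<close> to lower
  even moments, with division by \<open>4z\<close> only, which is a unit modulo \<open>p\<close>.
\<close>

section \<open>Coefficients of the Delannoy polynomials\<close>

definition delannoy_coeff :: "nat \<Rightarrow> nat \<Rightarrow> int" where
  "delannoy_coeff k i = int (k choose i) * int ((k + i) choose i)"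

text \<open>The added terms vanish, since \<open>k choose i = 0\<close> for \<open>i > k\<close>.
  This lets polynomials of different index be compared over one common range.\<close>

lemma delannoy_poly_eq_sum:
  assumes "k \<le> N"
  shows "delannoy_poly k z = (\<Sum>i\<le>N. delannoy_coeff k i * z ^ i)"
  unfolding delannoy_poly_def delannoy_coeff_def using assms
  by (intro sum.mono_neutral_left) auto

lemma int_binomial_Suc_Suc:
  "(int i + 1) * int (Suc n choose Suc i) = (int n + 1) * int (n choose i)"
  using arg_cong[OF Suc_times_binomial[of i n], of int]
  by (simp only: of_nat_mult of_nat_Suc add.commute)

text \<open>The subtraction is one of integers, so no assumption \<open>i \<le> n\<close> is needed:
  for \<open>i > n\<close> both sides are zero.\<close>

lemma binomial_Suc_bottom:
  "(int i + 1) * int (n choose Suc i) = (int n - int i) * int (n choose i)"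
  using int_binomial_Suc_Suc[of i n] by (simp add: algebra_simps)

lemma binomial_Suc_top:
  "(int n + 1 - int i) * int (Suc n choose i) = (int n + 1) * int (n choose i)"
  using binomial_Suc_bottom[of i "Suc n"] int_binomial_Suc_Suc[of i n]
  by (simp del: Binomial.binomial_Suc_Suc add: algebra_simps)

text \<open>This lemma and the next two serve to express the coefficients at \<open>Suc i\<close> of
  three consecutive polynomials through the single coefficient at \<open>i\<close> of the middle
  one.\<close>

lemma delannoy_coeff_Suc_right:
  "(int i + 1)\<^sup>2 * delannoy_coeff n (Suc i) =
     (int n - int i) * (int n + int i + 1) * delannoy_coeff n i"
proof -
  have "(int i + 1)\<^sup>2 * delannoy_coeff n (Suc i) =
      ((int i + 1) * int (n choose Suc i)) * ((int i + 1) * int (Suc (n + i) choose Suc i))"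
    by (simp add: delannoy_coeff_def power2_eq_square)
  also have "\<dots> = (int n - int i) * (int n + int i + 1) * delannoy_coeff n i"
    unfolding binomial_Suc_bottom[of i n] int_binomial_Suc_Suc by (simp add: delannoy_coeff_def)
  finally show ?thesis .
qed

lemma delannoy_coeff_Suc_Suc:
  "(int i + 1)\<^sup>2 * delannoy_coeff (Suc n) (Suc i) =
     (int n + int i + 2) * (int n + int i + 1) * delannoy_coeff n i"
proof -
  have "(int i + 1)\<^sup>2 * delannoy_coeff (Suc n) (Suc i) =
      ((int i + 1) * int (Suc n choose Suc i)) * ((int i + 1) * int (Suc (Suc (n + i)) choose Suc i))"
    by (simp add: delannoy_coeff_def power2_eq_square)
  also have "\<dots> = (int n + int i + 2) * int (n choose i) *
      ((int (n + i) + 1 - int i) * int (Suc (n + i) choose i))"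
    unfolding int_binomial_Suc_Suc by simp
  also have "\<dots> = (int n + int i + 2) * (int n + int i + 1) * delannoy_coeff n i"
    using binomial_Suc_top[of "n + i" i] by (simp add: delannoy_coeff_def algebra_simps)
  finally show ?thesis .
qed

lemma delannoy_coeff_Suc_right_pred:
  "(int i + 1)\<^sup>2 * delannoy_coeff n (Suc i) =
     (int n - int i) * (int n + 1 - int i) * delannoy_coeff (Suc n) i"
proof -
  have "(int i + 1)\<^sup>2 * delannoy_coeff n (Suc i) =
      ((int i + 1) * int (n choose Suc i)) * ((int i + 1) * int (Suc (n + i) choose Suc i))"
    by (simp add: delannoy_coeff_def power2_eq_square)
  \<comment> \<open>The factor \<open>int n + 1\<close> is produced by the second binomial and is
    regrouped with \<open>n choose i\<close>, where \<open>binomial_Suc_top\<close> turns it into a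
    multiple of \<open>Suc n choose i\<close>.\<close>
  also have "\<dots> = (int n - int i) * ((int n + 1) * int (n choose i)) * int (Suc (n + i) choose i)"
    unfolding binomial_Suc_bottom[of i n] using binomial_Suc_bottom[of i "Suc (n + i)"] by simp
  also have "\<dots> = (int n - int i) * (int n + 1 - int i) * delannoy_coeff (Suc n) i"
    unfolding binomial_Suc_top[symmetric] by (simp add: delannoy_coeff_def)
  finally show ?thesis .
qed

text \<open>After multiplication by \<open>(int i + 1)\<^sup>2\<close> every term is a multiple of
  \<open>delannoy_coeff (k + 1) i\<close>. What remains is a polynomial identity in \<open>k\<close>
  and \<open>i\<close>, and the nonzero square cancels.\<close>

lemma delannoy_coeff_recurrence:
  "(int k + 2) * delannoy_coeff (k + 2) (Suc i) + (int k + 1) * delannoy_coeff k (Suc i) =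
     (2 * int k + 3) * (delannoy_coeff (k + 1) (Suc i) + 2 * delannoy_coeff (k + 1) i)"
proof -
  define e where "e = delannoy_coeff (Suc k) i"
  have 1: "(int i + 1)\<^sup>2 * delannoy_coeff (k + 2) (Suc i) = (int k + int i + 3) * (int k + int i + 2) * e"
    using delannoy_coeff_Suc_Suc[of i "Suc k"] by (simp add: e_def algebra_simps)
  have 2: "(int i + 1)\<^sup>2 * delannoy_coeff k (Suc i) = (int k - int i) * (int k + 1 - int i) * e"
    using delannoy_coeff_Suc_right_pred[of i k] by (simp add: e_def)
  have 3: "(int i + 1)\<^sup>2 * delannoy_coeff (k + 1) (Suc i) = (int k + 1 - int i) * (int k + int i + 2) * e"
    using delannoy_coeff_Suc_right[of i "Suc k"] by (simp add: e_def algebra_simps)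
  have "(int i + 1)\<^sup>2 * ((int k + 2) * delannoy_coeff (k + 2) (Suc i) + (int k + 1) * delannoy_coeff k (Suc i))
     = (int k + 2) * ((int i + 1)\<^sup>2 * delannoy_coeff (k + 2) (Suc i)) +
       (int k + 1) * ((int i + 1)\<^sup>2 * delannoy_coeff k (Suc i))"
    by (simp add: algebra_simps)
  also have "\<dots> = (2 * int k + 3) * ((int i + 1)\<^sup>2 * delannoy_coeff (k + 1) (Suc i) + 2 * (int i + 1)\<^sup>2 * e)"
    unfolding 1 2 3 by algebra
  also have "\<dots> = (int i + 1)\<^sup>2 *
      ((2 * int k + 3) * (delannoy_coeff (k + 1) (Suc i) + 2 * delannoy_coeff (k + 1) i))"
    by (simp add: e_def algebra_simps)
  finally show ?thesis by simp
qed

section \<open>Three-term recurrence and Abel summation\<close>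

lemma delannoy_poly_recurrence:
  "(int k + 2) * delannoy_poly (k + 2) z =
     (2 * int k + 3) * (2 * z + 1) * delannoy_poly (k + 1) z - (int k + 1) * delannoy_poly k z"
proof -
  define d where "d = delannoy_coeff"
  \<comment> \<open>The constant term 1 is split off because
    \<open>delannoy_coeff_recurrence\<close> only covers positive exponents
    \<open>Suc i\<close>.\<close>
  have D: "delannoy_poly j z = 1 + (\<Sum>i\<le>Suc k. d j (Suc i) * z ^ Suc i)" if "j \<le> k + 2" for j
    using delannoy_poly_eq_sum[of j "Suc (Suc k)" z] that
    by (simp add: d_def sum.atMost_Suc_shift delannoy_coeff_def del: sum.atMost_Suc)
  \<comment> \<open>The middle polynomial is also needed unshifted: in the product with
    \<open>2 * z\<close> the exponent \<open>i\<close> becomes \<open>Suc i\<close>.\<close>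
  have D1: "delannoy_poly (k + 1) z = (\<Sum>i\<le>Suc k. d (k + 1) i * z ^ i)"
    by (simp add: d_def delannoy_poly_eq_sum del: sum.atMost_Suc)
  have "(int k + 2) * delannoy_poly (k + 2) z + (int k + 1) * delannoy_poly k z
      = (2 * int k + 3) + (\<Sum>i\<le>Suc k. ((int k + 2) * d (k + 2) (Suc i) + (int k + 1) * d k (Suc i)) * z ^ Suc i)"
    by (simp add: D algebra_simps sum.distrib sum_distrib_left del: sum.atMost_Suc)
  also have "\<dots> = (2 * int k + 3) + (\<Sum>i\<le>Suc k. (2 * int k + 3) * (d (k + 1) (Suc i) * z ^ Suc i)
      + (2 * int k + 3) * (2 * z) * (d (k + 1) i * z ^ i))"
    unfolding d_def delannoy_coeff_recurrence
    by (intro arg_cong2[where f = "(+)"] sum.cong refl) (simp add: algebra_simps)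
  also have "\<dots> = (2 * int k + 3) * (1 + (\<Sum>i\<le>Suc k. d (k + 1) (Suc i) * z ^ Suc i))
      + (2 * int k + 3) * (2 * z) * (\<Sum>i\<le>Suc k. d (k + 1) i * z ^ i)"
    unfolding sum.distrib sum_distrib_left[symmetric] by (simp only: distrib_left mult_1_right add.assoc)
  also have "\<dots> = (2 * int k + 3) * (2 * z + 1) * delannoy_poly (k + 1) z"
    using D[of "k + 1"] D1 by (simp add: algebra_simps del: sum.atMost_Suc)
  finally show ?thesis by simp
qed

text \<open>The recurrence is moved from the polynomials to \<open>f\<close>, which leaves a
  boundary term only at the upper end: at \<open>k = 0\<close> the value \<open>f (-1)\<close> has
  factor 0. The factor \<open>int m + 1\<close> on the right is the later modulus.\<close>

lemma delannoy_poly_summation_by_parts: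
  fixes f :: "int \<Rightarrow> int"
  shows "(\<Sum>k = 0..m. (int k * f (int k - 1) + (int k + 1) * f (int k + 1)
              - (2 * int k + 1) * (2 * z + 1) * f (int k)) * delannoy_poly k z)
         = (int m + 1) * (f (int m + 1) * delannoy_poly m z - f (int m) * delannoy_poly (m + 1) z)"
proof (induction m)
  case 0
  then show ?case by (simp add: delannoy_poly_def algebra_simps)
next
  case (Suc m)
  let ?D = "\<lambda>k. delannoy_poly k z"
  \<comment> \<open>Weighted by \<open>f (int m + 1)\<close>, the recurrence replaces the old
    boundary term by the new one, and the \<open>f (int m)\<close> terms cancel.\<close>
  have "f (int m + 1) * ((int m + 2) * ?D (m + 2)) =
    f (int m + 1) * ((2 * int m + 3) * (2 * z + 1) * ?D (m + 1) - (int m + 1) * ?D m)"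
    by (simp only: delannoy_poly_recurrence)
  then show ?case unfolding sum.atLeast0_atMost_Suc Suc.IH by (simp add: algebra_simps)
qed

section \<open>Shifted odd powers as polynomials in the square\<close>

text \<open>
  The recursion in the proof comes from \<open>(x + 2)\<^sup>2\<close> and \<open>(x - 2)\<^sup>2\<close> being the roots of
  \<open>t\<^sup>2 - 2(x\<^sup>2 + 4) t + (x\<^sup>2 - 4)\<^sup>2\<close>.
\<close>

lemma even_polynomial_of_shifted_odd_powers:
  "\<exists>q :: int poly. degree q \<le> n \<and> (\<forall>x. (x + 1) * (x + 2) ^ (2 * n + 1) + (x - 1) * (x - 2) ^ (2 * n + 1)
      = 2 * x ^ (2 * n + 2) + poly q (x\<^sup>2))"
proof (induction n rule: induct_nat_012)
  case 0
  show ?case by (rule exI[of _ "[:4:]"]) (simp add: power2_eq_square algebra_simps)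
next
  case 1
  show ?case
    by (rule exI[of _ "[:16, 36:]"]) (simp add: eval_nat_numeral algebra_simps)
next
  case (ge2 n)
  obtain q0 :: "int poly" where q0: "degree q0 \<le> n"
    "\<And>x. (x + 1) * (x + 2) ^ (2 * n + 1) + (x - 1) * (x - 2) ^ (2 * n + 1) = 2 * x ^ (2 * n + 2) + poly q0 (x\<^sup>2)"
    using ge2(1) by blast
  obtain q1 :: "int poly" where q1: "degree q1 \<le> Suc n"
    "\<And>x. (x + 1) * (x + 2) ^ (2 * Suc n + 1) + (x - 1) * (x - 2) ^ (2 * Suc n + 1) = 2 * x ^ (2 * Suc n + 2) + poly q1 (x\<^sup>2)"
    using ge2(2) by blast
  \<comment> \<open>With \<open>y = x\<^sup>2\<close>, the factors \<open>[:8, 2:]\<close> and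
    \<open>[:16, -8, 1:]\<close> are \<open>2 * (y + 4)\<close> and \<open>(y - 4)\<^sup>2\<close>.
    The monomials are what \<open>2 * (y + 4) * 2 * y ^ (n + 2) - (y - 4)\<^sup>2 * 2 * y ^ (n +
    1)\<close> leaves beyond \<open>2 * y ^ (n + 3)\<close>.\<close>
  define q :: "int poly" where "q = monom 32 (n + 2) - monom 32 (n + 1) + [:8, 2:] * q1 - [:16, -8, 1:] * q0"
  have "degree ([:8, 2:] * q1) \<le> n + 2" "degree ([:16, -8, 1:] * q0) \<le> n + 2"
    using q0(1) q1(1) by (auto intro!: order.trans[OF degree_mult_le] simp del: mult_pCons_left)
  then have "degree q \<le> n + 2"
    unfolding q_def by (intro degree_diff_le degree_add_le) (auto intro!: order.trans[OF degree_monom_le])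
  moreover have "(x + 1) * (x + 2) ^ (2 * (n + 2) + 1) + (x - 1) * (x - 2) ^ (2 * (n + 2) + 1)
      = 2 * x ^ (2 * (n + 2) + 2) + poly q (x\<^sup>2)" for x
  proof -
    define y where "y = x\<^sup>2"
    let ?A = "\<lambda>n. (x + 1) * (x + 2) ^ (2 * n + 1) + (x - 1) * (x - 2) ^ (2 * n + 1)"
    have pw: "x ^ (2 * m) = y ^ m" for m by (simp add: y_def power_mult)
    have "?A (n + 2) = 2 * (y + 4) * ?A (Suc n) - (y - 4)\<^sup>2 * ?A n"
    proof -
      have "(x + 2) ^ (2 * (n + 2) + 1) = 2 * (y + 4) * (x + 2) ^ (2 * Suc n + 1) - (y - 4)\<^sup>2 * (x + 2) ^ (2 * n + 1)"
        "(x - 2) ^ (2 * (n + 2) + 1) = 2 * (y + 4) * (x - 2) ^ (2 * Suc n + 1) - (y - 4)\<^sup>2 * (x - 2) ^ (2 * n + 1)"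
        unfolding y_def by (simp_all add: power_add) algebra+
      then show ?thesis by (simp only:) (simp only: ring_distribs mult_ac add_ac diff_diff_eq2 diff_diff_eq diff_add_eq add_diff_eq)
    qed
    also have "\<dots> = 2 * (y + 4) * (2 * y ^ (n + 2) + poly q1 y) - (y - 4)\<^sup>2 * (2 * y ^ (n + 1) + poly q0 y)"
      unfolding q0(2) q1(2) using pw[of "n + 2"] pw[of "n + 1"] by (simp add: y_def)
    also have "\<dots> = 2 * y ^ (n + 3) + poly q y"
      by (simp add: q_def poly_monom power2_eq_square power_add eval_nat_numeral algebra_simps)
    also have "2 * y ^ (n + 3) = 2 * x ^ (2 * (n + 2) + 2)"
      using pw[of "n + 3"] by (simp only: distrib_left add.assoc) simp
    finally show ?thesis unfolding y_def .
  qed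
  ultimately show ?case by auto
qed

section \<open>Reduction of even moments\<close>

definition delannoy_moment :: "nat \<Rightarrow> int \<Rightarrow> nat \<Rightarrow> int" where
  "delannoy_moment j z m = (\<Sum>k = 0..m. (2 * int k + 1) ^ (2 * j) * delannoy_poly k z)"

text \<open>The numbers \<open>a j\<close> are the coefficients of the polynomial \<open>q\<close>
  for shifted odd powers. They are chosen before \<open>m\<close>, which is what later makes the
  constant independent of \<open>p = m + 1\<close>.\<close>

lemma delannoy_moment_reduction:
  "\<exists>a :: nat \<Rightarrow> int. \<forall>m. (int m + 1) dvd
     4 * z * delannoy_moment (Suc n) z m - (\<Sum>j\<le>n. a j * delannoy_moment j z m)"
proof -
  obtain q :: "int poly" where q: "degree q \<le> n"
    "\<And>x. (x + 1) * (x + 2) ^ (2 * n + 1) + (x - 1) * (x - 2) ^ (2 * n + 1) = 2 * x ^ (2 * n + 2) + poly q (x\<^sup>2)"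
    using even_polynomial_of_shifted_odd_powers by blast
  have "(int m + 1) dvd 4 * z * delannoy_moment (Suc n) z m - (\<Sum>j\<le>n. coeff q j * delannoy_moment j z m)" for m
  proof -
    define f where "f t = (2 * t + 1) ^ (2 * n + 1)" for t :: int
    let ?L = "\<lambda>k. int k * f (int k - 1) + (int k + 1) * f (int k + 1) - (2 * int k + 1) * (2 * z + 1) * f (int k)"
    \<comment> \<open>For \<open>x = 2 * k + 1\<close> the weights \<open>k\<close> and
      \<open>k + 1\<close> are \<open>(x - 1) / 2\<close> and \<open>(x + 1) / 2\<close>, and
      doubling clears the halves. The leading terms \<open>2 - 2 * (2 * z + 1)\<close> combine to
      \<open>- 4 * z\<close>.\<close>
    have L: "2 * ?L k = (\<Sum>j\<le>n. coeff q j * (2 * int k + 1) ^ (2 * j)) - 4 * z * (2 * int k + 1) ^ (2 * Suc n)" for k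
    proof -
      define x where "x = 2 * int k + 1"
      have "2 * ?L k = (x + 1) * (x + 2) ^ (2 * n + 1) + (x - 1) * (x - 2) ^ (2 * n + 1)
          - 2 * (2 * z + 1) * x ^ (2 * n + 2)"
        unfolding f_def x_def by (simp add: algebra_simps)
      also have "\<dots> = poly q (x\<^sup>2) - 4 * z * x ^ (2 * Suc n)"
        unfolding q(2) by (simp add: algebra_simps)
      also have "poly q (x\<^sup>2) = (\<Sum>j\<le>n. coeff q j * x ^ (2 * j))"
        using arg_cong[OF poly_as_sum_of_monoms'[OF q(1)], of "\<lambda>q. poly q (x\<^sup>2)"]
        by (simp add: poly_sum poly_monom flip: power_mult)
      finally show ?thesis by (simp add: x_def)
    qed
    have "(int m + 1) dvd (\<Sum>k = 0..m. ?L k * delannoy_poly k z)"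
      unfolding delannoy_poly_summation_by_parts by simp
    then have "(int m + 1) dvd - (2 * (\<Sum>k = 0..m. ?L k * delannoy_poly k z))" by simp
    also have "- (2 * (\<Sum>k = 0..m. ?L k * delannoy_poly k z)) = - (\<Sum>k = 0..m. (2 * ?L k) * delannoy_poly k z)"
      by (simp only: sum_distrib_left mult.assoc)
    also have "(\<Sum>k = 0..m. (2 * ?L k) * delannoy_poly k z) =
        (\<Sum>k = 0..m. \<Sum>j\<le>n. coeff q j * ((2 * int k + 1) ^ (2 * j) * delannoy_poly k z))
        - 4 * z * delannoy_moment (Suc n) z m"
      unfolding L delannoy_moment_def
      by (simp only: left_diff_distrib sum_subtractf sum_distrib_left sum_distrib_right mult.assoc)
    also have "(\<Sum>k = 0..m. \<Sum>j\<le>n. coeff q j * ((2 * int k + 1) ^ (2 * j) * delannoy_poly k z)) =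
        (\<Sum>j\<le>n. coeff q j * delannoy_moment j z m)"
      unfolding delannoy_moment_def sum_distrib_left by (rule sum.swap)
    finally show ?thesis by simp
  qed
  then show ?thesis by blast
qed

text \<open>Iterating the reduction expresses each moment through the zeroth one. The power of
  \<open>4 * z\<close> clears the denominators, so the argument stays in the integers and holds for
  every modulus \<open>m + 1\<close>.\<close>

lemma delannoy_moment_proportional:
  "\<exists>C :: int. \<forall>m. (int m + 1) dvd (4 * z) ^ n * delannoy_moment n z m - C * delannoy_moment 0 z m"
proof (induction n rule: less_induct)
  case (less n)
  show ?case
  proof (cases n)
    case 0
    then show ?thesis by (intro exI[of _ 1]) simp
  next
    case (Suc n')
    obtain a :: "nat \<Rightarrow> int" where a: "\<And>m. (int m + 1) dvd
        4 * z * delannoy_moment (Suc n') z m - (\<Sum>j\<le>n'. a j * delannoy_moment j z m)"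
      using delannoy_moment_reduction by blast
    have "\<forall>j\<in>{..n'}. \<exists>C :: int. \<forall>m. (int m + 1) dvd (4 * z) ^ j * delannoy_moment j z m - C * delannoy_moment 0 z m"
      using less.IH Suc by auto
    then obtain C :: "nat \<Rightarrow> int" where C: "\<And>j m. j \<le> n' \<Longrightarrow>
        (int m + 1) dvd (4 * z) ^ j * delannoy_moment j z m - C j * delannoy_moment 0 z m"
      unfolding bchoice_iff by auto
    define w where "w = 4 * z"
    \<comment> \<open>The constant arises by multiplying the reduction by \<open>w ^ n'\<close> and,
      since \<open>j \<le> n'\<close>, using \<open>w ^ j\<close> of that factor for the induction
      hypothesis at \<open>j\<close>.\<close>
    have "(int m + 1) dvd w ^ n * delannoy_moment n z m
        - (\<Sum>j\<le>n'. a j * w ^ (n' - j) * C j) * delannoy_moment 0 z m" for m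
    proof -
      let ?M = "\<lambda>j. delannoy_moment j z m"
      have "w ^ n * ?M n - (\<Sum>j\<le>n'. a j * w ^ (n' - j) * C j) * ?M 0 =
          w ^ n' * (w * ?M n - (\<Sum>j\<le>n'. a j * ?M j)) +
          (\<Sum>j\<le>n'. a j * w ^ n' * ?M j - a j * w ^ (n' - j) * C j * ?M 0)"
        by (simp add: Suc sum_subtractf sum_distrib_left sum_distrib_right algebra_simps)
      also have "(\<Sum>j\<le>n'. a j * w ^ n' * ?M j - a j * w ^ (n' - j) * C j * ?M 0) =
          (\<Sum>j\<le>n'. a j * w ^ (n' - j) * (w ^ j * ?M j - C j * ?M 0))"
      proof (rule sum.cong)
        fix j assume "j \<in> {..n'}"
        then have "w ^ n' = w ^ (n' - j) * w ^ j" by (simp flip: power_add)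
        then show "a j * w ^ n' * ?M j - a j * w ^ (n' - j) * C j * ?M 0 =
            a j * w ^ (n' - j) * (w ^ j * ?M j - C j * ?M 0)"
          by (simp add: algebra_simps)
      qed simp
      finally show ?thesis using a[of m] C[of _ m] by (auto simp: w_def Suc intro!: dvd_add dvd_mult dvd_sum)
    qed
    then show ?thesis unfolding w_def by blast
  qed
qed

section \<open>Passage to p-adic integers\<close>

lemma padic_integral_divide:
  assumes "prime p" "\<not> int p dvd b"
  shows "padic_integral p (of_int a / of_int b)"
proof -
  obtain n d where nd: "quotient_of (of_int a / of_int b) = (n, d)" by force
  have "b \<noteq> 0" using assms(2) by auto
  have d: "d > 0" "coprime n d" "(of_int a / of_int b :: rat) = of_int n / of_int d"
    using quotient_of_denom_pos[OF nd] quotient_of_coprime[OF nd] quotient_of_div[OF nd] by auto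
  \<comment> \<open>Cross-multiplication shows that the reduced denominator \<open>d\<close> divides
    \<open>n * b\<close>; being coprime to \<open>n\<close>, it divides \<open>b\<close>, hence is
    prime to \<open>p\<close>.\<close>
  then have "(of_int (a * d) :: rat) = of_int (n * b)" using \<open>b \<noteq> 0\<close> by (simp add: field_simps)
  then have "d dvd n * b" by (metis of_int_eq_iff dvd_triv_right)
  then have "d dvd b" using d(2) by (simp add: coprime_commute coprime_dvd_mult_right_iff)
  then show ?thesis using assms(2) nd unfolding padic_integral_def by (auto dest: dvd_trans)
qed

theorem theorem3p6:
  fixes z :: int
  assumes "z \<noteq> 0"
  shows "\<exists>c :: nat \<Rightarrow> rat. \<forall>(p :: nat) (r :: nat).
           prime p \<and> odd p \<and> gcd (int p) z = 1 \<longrightarrow>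
             padic_integral p (c r) \<and>
             padic_cong p
               (of_int (\<Sum>k = 0..p - 1. (2 * int k + 1) ^ (2 * r + 2) * delannoy_poly k z))
               (c r * of_int (\<Sum>k = 0..p - 1. delannoy_poly k z))"
proof -
  obtain C :: "nat \<Rightarrow> int" where C: "\<And>n m. (int m + 1) dvd
      (4 * z) ^ n * delannoy_moment n z m - C n * delannoy_moment 0 z m"
    using delannoy_moment_proportional by metis
  \<comment> \<open>The constant will be \<open>C (Suc r) / b r\<close>: the exponent
    \<open>2 * r + 2\<close> belongs to the moment of index \<open>Suc r\<close>. Neither
    \<open>C\<close> nor \<open>b\<close> depends on \<open>p\<close>.\<close>
  define b where "b r = (4 * z) ^ Suc r" for r
  have "padic_integral p (of_int (C (Suc r)) / of_int (b r)) \<and>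
      padic_cong p
        (of_int (\<Sum>k = 0..p - 1. (2 * int k + 1) ^ (2 * r + 2) * delannoy_poly k z))
        (of_int (C (Suc r)) / of_int (b r) * of_int (\<Sum>k = 0..p - 1. delannoy_poly k z))"
    if p: "prime p" "odd p" "gcd (int p) z = 1" for p r
  proof -
    have ip: "prime (int p)" using p(1) by simp
    have "\<not> int p dvd z" using p(3) ip by (metis gcd_proj1_iff not_prime_1 normalize_int_def abs_of_nat)
    moreover have "\<not> int p dvd 4"
    proof
      assume "int p dvd 4"
      then have "int p dvd 2 ^ 2" by simp
      then have "int p dvd 2" using ip prime_dvd_power by blast
      then show False using p(1,2) by (metis int_dvd_int_iff of_nat_numeral primes_dvd_imp_eq two_is_prime_nat even_numeral dvd_refl)
    qed
    ultimately have b: "\<not> int p dvd b r"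
      unfolding b_def using ip by (metis prime_dvd_mult_iff prime_dvd_power)
    then have b0: "b r \<noteq> 0" by auto
    have M: "delannoy_moment (Suc r) z (p - 1) = (\<Sum>k = 0..p - 1. (2 * int k + 1) ^ (2 * r + 2) * delannoy_poly k z)"
      "delannoy_moment 0 z (p - 1) = (\<Sum>k = 0..p - 1. delannoy_poly k z)"
      by (simp_all add: delannoy_moment_def)
    \<comment> \<open>The moments run up to \<open>m = p - 1\<close>, so the modulus
      \<open>m + 1\<close> is \<open>p\<close>; positivity of \<open>p\<close> makes the truncated
      subtraction exact.\<close>
    have "int (p - 1) + 1 = int p" using prime_gt_0_nat[OF p(1)] by simp
    then obtain t where t: "b r * delannoy_moment (Suc r) z (p - 1) - C (Suc r) * delannoy_moment 0 z (p - 1) = int p * t"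
      using C[of "p - 1" "Suc r"] unfolding b_def by (metis dvdE)
    have "(of_int (b r) * of_int (delannoy_moment (Suc r) z (p - 1))
        - of_int (C (Suc r)) * of_int (delannoy_moment 0 z (p - 1)) :: rat) = of_nat p * of_int t"
      using arg_cong[OF t, of "of_int :: int \<Rightarrow> rat"] by simp
    then have "of_int (delannoy_moment (Suc r) z (p - 1))
        - of_int (C (Suc r)) / of_int (b r) * of_int (delannoy_moment 0 z (p - 1)) =
        (of_nat p * (of_int t / of_int (b r)) :: rat)"
      using b0 by (simp add: field_simps)
    then show ?thesis
      using padic_integral_divide[OF p(1) b] unfolding padic_cong_def M by blast
  qed
  then show ?thesis by (intro exI[of _ "\<lambda>r. of_int (C (Suc r)) / of_int (b r)"] allI impI) (elim conjE)
qed

end
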